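(* Let $p$ be a prime and let $\ell$ be an integer with $1\leq \ell\leq p-1$ that is relatively prime to $p-1$. For $1\leq k\leq p-1$, the number of increasing integer sequences $1\leq a_1<a_2<\cdots<a_\ell\leq p-1$ whose product $a_1a_2\cdots a_\ell$ is congruent to $k$ modulo $p$ is independent of $k$, and equal to $\frac{1}{p-1}\binom{p-1}{\ell}$.
   Context: Increasing means strictly increasing; the bounds $1$ and $p-1$ are inclusive. *)

theory Defs
  imports Complex_Main "HOL-Number_Theory.Number_Theory"
begin

definition inc_seqs :: "nat \<Rightarrow> nat \<Rightarrow> nat \<Rightarrow> nat list set" where
  "inc_seqs p l k =
     {a. length a = l \<and> sorted_wrt (<) a \<and> set a \<subseteq> {1..p - 1} \<and> [prod_list a = k] (mod p)}"

end

theory Submission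
  imports Defs
begin

text \<open>
  An increasing sequence in \<open>{1..p - 1}\<close> is the same thing as a subset of that interval, so the
  question is how the products of the \<open>l\<close>-element sets of nonzero residues are distributed.
  Multiplying every element of such a set by a unit \<open>c\<close> is injective on these sets and multiplies
  the product by \<open>c ^ l\<close> (lemma \<open>card_residue_sets_le\<close>). Because \<open>l\<close> is coprime to the order
  \<open>p - 1\<close> of the group of units, every unit is an \<open>l\<close>-th power (lemma \<open>exists_power_root_mod_prime\<close>),
  so sets with product \<open>k\<close> can be moved injectively to sets with product \<open>k'\<close>, for any \<open>k\<close> and
  \<open>k'\<close>. Hence all the \<open>p - 1\<close> product classes have the same size; together they make up all
  \<open>l\<close>-element subsets, whose number is the binomial coefficient.
\<close>

definition residue_sets :: "nat \<Rightarrow> nat \<Rightarrow> nat \<Rightarrow> nat set set" where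
  "residue_sets p l k = {A. A \<subseteq> {1..p - 1} \<and> card A = l \<and> [\<Prod>A = k] (mod p)}"

lemma finite_residue_sets: "finite (residue_sets p l k)"
  by (rule finite_subset[of _ "Pow {1..p - 1}"]) (auto simp: residue_sets_def)

lemma card_inc_seqs: "card (inc_seqs p l k) = card (residue_sets p l k)"
proof (rule bij_betw_same_card)
  show "bij_betw set (inc_seqs p l k) (residue_sets p l k)"
  proof (rule bij_betw_byWitness[where f' = sorted_list_of_set])
    show "\<forall>a\<in>inc_seqs p l k. sorted_list_of_set (set a) = a"
      by (auto simp: inc_seqs_def strict_sorted_iff sorted_list_of_set.idem_if_sorted_distinct)
    show "\<forall>A\<in>residue_sets p l k. set (sorted_list_of_set A) = A"
      by (auto simp: residue_sets_def dest: finite_subset)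
    show "set ` inc_seqs p l k \<subseteq> residue_sets p l k"
      by (auto simp: inc_seqs_def residue_sets_def strict_sorted_iff distinct_card
          prod.distinct_set_conv_list)
    show "sorted_list_of_set ` residue_sets p l k \<subseteq> inc_seqs p l k"
    proof safe
      fix A assume A: "A \<in> residue_sets p l k"
      then have fin: "finite A"
        by (auto simp: residue_sets_def dest: finite_subset)
      have "prod_list (sorted_list_of_set A) = \<Prod>A"
        using prod.distinct_set_conv_list[of "sorted_list_of_set A" id] fin by simp
      with A fin show "sorted_list_of_set A \<in> inc_seqs p l k"
        by (simp add: inc_seqs_def residue_sets_def)
    qed
  qed
qed

lemma coprime_prime_interval:
  fixes p k :: nat
  assumes "prime p" "k \<in> {1..p - 1}"
  shows "coprime k p"
proof -
  have "\<not> p dvd k"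
    using assms by (auto dest!: dvd_imp_le)
  then show ?thesis
    using assms(1) prime_imp_coprime coprime_commute by blast
qed

text \<open>
  If \<open>l * m\<close> is 1 modulo \<open>p - 1\<close>, then \<open>u ^ m\<close> is an \<open>l\<close>-th root of \<open>u\<close>, since exponents of units
  only matter modulo the group order.
\<close>

lemma exists_power_root_mod_prime:
  fixes p l u :: nat
  assumes "prime p" "coprime l (p - 1)" "coprime u p"
  obtains c where "coprime c p" "[c ^ l = u] (mod p)"
proof -
  obtain m where m: "[l * m = 1] (mod p - 1)"
    using cong_solve_coprime_nat[OF assms(2)] by auto
  have cop: "coprime p u"
    using assms(3) by (simp add: coprime_commute)
  have "ord p u dvd p - 1"
    using order_divides_totient[OF cop] totient_prime[OF assms(1)] by simp
  then have "[m * l = 1] (mod ord p u)"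
    using m by (metis cong_dvd_modulus_nat mult.commute)
  then have "[u ^ (m * l) = u ^ 1] (mod p)"
    using order_divides_expdiff[OF cop] by blast
  then have "[(u ^ m) ^ l = u] (mod p)"
    by (simp add: power_mult)
  moreover have "coprime (u ^ m) p"
    using assms(3) by simp
  ultimately show ?thesis
    using that by blast
qed

lemma inj_on_mult_mod:
  fixes p c :: nat
  assumes "coprime c p"
  shows "inj_on (\<lambda>a. c * a mod p) {1..p - 1}"
proof (rule inj_onI)
  fix a b assume ab: "a \<in> {1..p - 1}" "b \<in> {1..p - 1}" "c * a mod p = c * b mod p"
  then have "[a = b] (mod p)"
    using cong_mult_lcancel_nat[OF assms] by (simp add: cong_def)
  then show "a = b"
    using ab by (auto simp: cong_def)
qed

text \<open>Scaling the elements by \<open>c\<close> is the injection that compares the two classes.\<close>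

lemma card_residue_sets_le:
  assumes "prime p" "coprime c p" "[c ^ l * k = k'] (mod p)"
  shows "card (residue_sets p l k) \<le> card (residue_sets p l k')"
proof (rule card_inj_on_le)
  let ?f = "\<lambda>a. c * a mod p"
  have inj: "inj_on ?f {1..p - 1}"
    by (rule inj_on_mult_mod[OF assms(2)])
  have range: "?f a \<in> {1..p - 1}" if "a \<in> {1..p - 1}" for a
  proof -
    have "coprime (c * a) p"
      using assms(2) coprime_prime_interval[OF assms(1) that] by simp
    then have "\<not> p dvd c * a"
      using assms(1) by (metis coprime_absorb_left coprime_commute not_prime_unit)
    then have "?f a \<noteq> 0"
      by (simp add: dvd_eq_mod_eq_0)
    moreover have "?f a < p"
      using assms(1) by (simp add: prime_gt_0_nat)
    ultimately show ?thesis
      by auto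
  qed
  show "inj_on ((`) ?f) (residue_sets p l k)"
    by (rule inj_on_subset[OF inj_on_image_Pow[OF inj]]) (auto simp: residue_sets_def)
  show "(`) ?f ` residue_sets p l k \<subseteq> residue_sets p l k'"
  proof safe
    fix A assume "A \<in> residue_sets p l k"
    then have A: "A \<subseteq> {1..p - 1}" "card A = l" "[\<Prod>A = k] (mod p)"
      by (auto simp: residue_sets_def)
    have injA: "inj_on ?f A"
      using inj A(1) by (rule inj_on_subset)
    have "\<Prod>(?f ` A) = (\<Prod>a\<in>A. ?f a)"
      using injA by (simp add: prod.reindex)
    also have "[\<dots> = (\<Prod>a\<in>A. c * a)] (mod p)"
      by (intro cong_prod) (simp add: cong_def)
    also have "(\<Prod>a\<in>A. c * a) = c ^ l * \<Prod>A"
      using A(2) by (simp add: prod.distrib)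
    also have "[\<dots> = c ^ l * k] (mod p)"
      using A(3) by (intro cong_mult) auto
    also note assms(3)
    finally show "?f ` A \<in> residue_sets p l k'"
      using A range injA by (auto simp: residue_sets_def card_image)
  qed
qed (rule finite_residue_sets)

lemma card_residue_sets_le_all:
  assumes "prime p" "coprime l (p - 1)" "k \<in> {1..p - 1}" "k' \<in> {1..p - 1}"
  shows "card (residue_sets p l k) \<le> card (residue_sets p l k')"
proof -
  have k: "coprime k p" and k': "coprime k' p"
    using assms coprime_prime_interval by auto
  obtain x where x: "[k * x = 1] (mod p)"
    using cong_solve_coprime_nat[OF k] by auto
  then have "coprime x p"
    by (metis coprime_iff_invertible_nat mult.commute One_nat_def)
  with k' have "coprime (x * k') p"
    by simp
  \<comment> \<open>The factor \<open>x * k'\<close> is the quotient \<open>k' / k\<close> that scaling by \<open>c\<close> has to produce.\<close>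
  then obtain c where c: "coprime c p" "[c ^ l = x * k'] (mod p)"
    using exists_power_root_mod_prime assms(1,2) by blast
  have "[c ^ l * k = x * k' * k] (mod p)"
    using c(2) by (rule cong_scalar_right)
  also have "x * k' * k = k * x * k'"
    by simp
  also have "[\<dots> = 1 * k'] (mod p)"
    using x by (rule cong_scalar_right)
  finally show ?thesis
    using card_residue_sets_le[OF assms(1) c(1)] by simp
qed

text \<open>
  A product of nonzero residues is a unit, so its residue is one of \<open>1, \<dots>, p - 1\<close>: the classes
  partition the \<open>l\<close>-element subsets.
\<close>

lemma sum_card_residue_sets:
  assumes "prime p"
  shows "(\<Sum>k=1..p - 1. card (residue_sets p l k)) = (p - 1) choose l"
proof -
  have "(\<Union>k\<in>{1..p - 1}. residue_sets p l k) = {A. A \<subseteq> {1..p - 1} \<and> card A = l}"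
  proof safe
    fix A assume A: "A \<subseteq> {1..p - 1}"
    have "coprime (\<Prod>A) p"
      using A coprime_prime_interval[OF assms] by (intro prod_coprime_left) auto
    then have "\<not> p dvd \<Prod>A"
      using assms by (metis coprime_absorb_left coprime_commute not_prime_unit)
    then have "\<Prod>A mod p \<noteq> 0"
      by (simp add: dvd_eq_mod_eq_0)
    moreover have "\<Prod>A mod p < p"
      using assms by (simp add: prime_gt_0_nat)
    ultimately have "\<Prod>A mod p \<in> {1..p - 1}"
      by auto
    moreover have "A \<in> residue_sets p (card A) (\<Prod>A mod p)"
      using A by (simp add: residue_sets_def cong_def)
    ultimately show "A \<in> (\<Union>k\<in>{1..p - 1}. residue_sets p (card A) k)"
      by blast
  qed (auto simp: residue_sets_def)
  moreover have "card (\<Union>k\<in>{1..p - 1}. residue_sets p l k)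
      = (\<Sum>k=1..p - 1. card (residue_sets p l k))"
  proof (rule card_UN_disjoint)
    show "\<forall>i\<in>{1..p - 1}. \<forall>j\<in>{1..p - 1}. i \<noteq> j \<longrightarrow>
        residue_sets p l i \<inter> residue_sets p l j = {}"
      by (auto simp: residue_sets_def cong_def)
  qed (auto simp: finite_residue_sets)
  ultimately show ?thesis
    using n_subsets[of "{1..p - 1}" l] by simp
qed

theorem theorem5:
  fixes p l :: nat
  assumes "prime p"
    and "1 \<le> l" and "l \<le> p - 1"
    and "coprime l (p - 1)"
  shows "(\<forall>k\<in>{1..p - 1}. \<forall>k'\<in>{1..p - 1}. card (inc_seqs p l k) = card (inc_seqs p l k'))
    \<and> (\<forall>k\<in>{1..p - 1}. real (card (inc_seqs p l k)) = 1 / real (p - 1) * real ((p - 1) choose l))"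
proof (intro conjI ballI)
  have same: "card (residue_sets p l k) = card (residue_sets p l k')"
    if "k \<in> {1..p - 1}" "k' \<in> {1..p - 1}" for k k'
    using card_residue_sets_le_all[OF assms(1,4)] that by (meson order_antisym)
  show "card (inc_seqs p l k) = card (inc_seqs p l k')"
    if "k \<in> {1..p - 1}" "k' \<in> {1..p - 1}" for k k'
    unfolding card_inc_seqs using that by (rule same)
  show "real (card (inc_seqs p l k)) = 1 / real (p - 1) * real ((p - 1) choose l)"
    if k: "k \<in> {1..p - 1}" for k
  proof -
    have "(p - 1) choose l = (\<Sum>j=1..p - 1. card (residue_sets p l j))"
      using sum_card_residue_sets[OF assms(1)] by simp
    also have "\<dots> = (\<Sum>j=1..p - 1. card (residue_sets p l k))"
      using k by (intro sum.cong refl same)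
    also have "\<dots> = (p - 1) * card (inc_seqs p l k)"
      by (simp add: card_inc_seqs)
    finally have "real ((p - 1) choose l) = real (p - 1) * real (card (inc_seqs p l k))"
      by (metis of_nat_mult)
    moreover have "real (p - 1) \<noteq> 0"
      using k by auto
    ultimately show ?thesis
      by (simp add: field_simps)
  qed
qed

end
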